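(* Let $\mathrm Y$ be a fixed, deterministic velocity model and let $\chi_m(\mathrm Y):=\tilde K(\mathrm Y)-K(\mathrm Y)$, where $K=\frac1{N_{\mathrm R}N_{\mathrm S}}\sum_{r=1}^{N_{\mathrm R}}\sum_{s=1}^{N_{\mathrm S}}K_{rs}$ and $\tilde K=\frac1{p_{\mathrm R}p_{\mathrm S}}\sum_{r\in\mathfrak R_m}\sum_{s\in\mathfrak S_m}K_{rs}$. Then $\mathbb E_{\mathrm S}[\chi_m(\mathrm Y)]=\mathbb E[\chi_m(\mathrm Y)]=0$ and $$\mathbb E_{\mathrm S}[\chi_m^2(\mathrm Y)]=\left(\frac1{p_{\mathrm R}}-\frac1{N_{\mathrm R}}\right)\Lambda_{\mathrm R},$$ $$\mathbb E[\chi_m^2(\mathrm Y)]=\left(\frac1{p_{\mathrm S}}-\frac1{N_{\mathrm S}}\right)\mathbb E\Lambda_{\mathrm S}+\mathbb E_{\mathrm S}[\chi_m^2(\mathrm Y)],$$ where $$\Lambda_{\mathrm R}=\frac1{N_{\mathrm R}-1}\sum_{r=1}^{N_{\mathrm R}}\left(K_r-\frac1{N_{\mathrm R}}\sum_{l=1}^{N_{\mathrm R}}K_l\right)^2,\qquad K_r=\frac1{N_{\mathrm S}}\sum_{s=1}^{N_{\mathrm S}}K_{rs},$$ $$\Lambda_{\mathrm S}=\frac1{N_{\mathrm S}-1}\sum_{s=1}^{N_{\mathrm S}}\left(\tilde K_s-\frac1{N_{\mathrm S}}\sum_{l=1}^{N_{\mathrm S}}\tilde K_l\right)^2,\qquad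 \tilde K_s=\frac1{p_{\mathrm R}}\sum_{r\in\mathfrak R_m}K_{rs}.$$
   Context: There are $N_{\mathrm R}$ receiver stations at locations $x_r$ and $N_{\mathrm S}$ earthquake events (sources) at locations $x_s$. A velocity model is $\mathrm Y=\log\rho$ with $\rho=\rho(x)$ a density. For each pair, $K_{rs}=K_{rs}(\mathrm Y)$ is the function of $x$ $$K_{rs}=\int_0^T\rho(x)\,\partial_tu^\dagger(T-t,x;x_r)\,\partial_tu(t,x;x_s)\,\mathrm dt,$$ where $u(\cdot,\cdot;x_s)$ solves $\rho\,\partial_t^2u-\Delta u=s(t,x)$ with zero initial data and source located at $x_s$, and $u^\dagger(\cdot,\cdot;x_r)$ solves $\rho\,\partial_t^2u^\dagger-\Delta u^\dagger=[u_{\mathrm{obs}}-u](T-t,x)\,\delta(x-x_r)$ with zero initial data ($u_{\mathrm{obs}}$ is the observed signal). All identities are pointwise in $x$. At iteration step $m$, a random receiver subset $\mathfrak R_m\subset\{1,\dots,N_{\mathrm R}\}$ of size $p_{\mathrm R}$ and a random source subset $\mathfrak S_m\subset\{1,\dots,N_{\mathrm S}\}$ of size $p_{\mathrm S}$ are chosen independently, each uniformly among subsets of the given size. $\mathbb E$ is expectation over both; $\mathbb E_{\mathrm S}[\,\cdot\,]:=\mathbb E[\,\cdot\,|\,\mathfrak S_m=\{1,\dots,N_{\mathrm S}\}]$ denotes the expectation over $\mathfrak R_m$ when the whole source set is used, i.e. $\mathfrak S_m$ is replaced by $\{1,\dots,N_{\mathrm S}\}$ and correspondingly $p_{\mathrm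 S}$ by $N_{\mathrm S}$ in $\tilde K$. *)

theory Defs
  imports "HOL-Probability.Probability"
begin

text \<open>Wave fields are functions \<open>u t x\<close> of time and space.  As the sources are concentrated at points,
  the wave equations are understood in the sense of distributions on space-time \<open>real \<times> 'a\<close>.\<close>

fun partials :: "'a::euclidean_space list \<Rightarrow> ('a \<Rightarrow> real) \<Rightarrow> 'a \<Rightarrow> real" where
  "partials [] f = f"
| "partials (i # is) f = (\<lambda>z. frechet_derivative (partials is f) (at z) i)"

text \<open>Smooth functions with compact support in \<open>D\<close>.\<close>
definition test_fun :: "'a::euclidean_space set \<Rightarrow> ('a \<Rightarrow> real) \<Rightarrow> bool" where
  "test_fun D \<phi> \<longleftrightarrow>
     (\<forall>is. set is \<subseteq> Basis \<longrightarrow> (\<forall>z. partials is \<phi> differentiable (at z))) \<and>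
     compact (closure {z. \<phi> z \<noteq> 0}) \<and> closure {z. \<phi> z \<noteq> 0} \<subseteq> D"

text \<open>In the continuity condition, \<open>B\<close> ranges over the bounds of the order-\<open>N\<close> seminorm of \<open>\<phi>\<close>.\<close>
definition distribution_on ::
    "'a::euclidean_space set \<Rightarrow> (('a \<Rightarrow> real) \<Rightarrow> real) \<Rightarrow> bool" where
  "distribution_on D F \<longleftrightarrow>
     (\<forall>\<phi> \<psi> a b. test_fun D \<phi> \<longrightarrow> test_fun D \<psi> \<longrightarrow>
        F (\<lambda>z. a * \<phi> z + b * \<psi> z) = a * F \<phi> + b * F \<psi>) \<and>
     (\<forall>C. compact C \<and> C \<subseteq> D \<longrightarrow>
        (\<exists>N c. \<forall>\<phi> B. test_fun D \<phi> \<and> closure {z. \<phi> z \<noteq> 0} \<subseteq> C \<and>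
           (\<forall>is z. set is \<subseteq> Basis \<and> length is \<le> N \<longrightarrow> \<bar>partials is \<phi> z\<bar> \<le> B) \<longrightarrow>
           \<bar>F \<phi>\<bar> \<le> c * B))"

definition supported_in ::
    "'a::euclidean_space set \<Rightarrow> (('a \<Rightarrow> real) \<Rightarrow> real) \<Rightarrow> 'a set \<Rightarrow> bool" where
  "supported_in D F C \<longleftrightarrow> (\<forall>\<phi>. test_fun (D - C) \<phi> \<longrightarrow> F \<phi> = 0)"

text \<open>The distribution \<open>g(t) \<delta>(x - y)\<close> on the time interval \<open>[0, T]\<close>.\<close>
definition point_source ::
    "real \<Rightarrow> (real \<Rightarrow> real) \<Rightarrow> 'a::euclidean_space \<Rightarrow> (real \<times> 'a \<Rightarrow> real) \<Rightarrow> real" where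
  "point_source T g y \<phi> = integral {0..T} (\<lambda>t. g t * \<phi> (t, y))"

text \<open>\<open>u\<close> solves \<open>\<rho> u\<^sub>t\<^sub>t - \<Delta>u = F\<close> in \<open>[0, T) \<times> \<Omega>\<close> with zero initial data.  The test functions need not
  vanish at time \<open>0\<close>, so the absence of initial terms expresses \<open>u = u\<^sub>t = 0\<close> at time \<open>0\<close>
  (equivalently: \<open>u\<close>, extended by \<open>0\<close> to negative times, solves the equation there as well).\<close>
definition weak_wave_solution ::
    "real \<Rightarrow> 'a::euclidean_space set \<Rightarrow> ('a \<Rightarrow> real) \<Rightarrow> ((real \<times> 'a \<Rightarrow> real) \<Rightarrow> real)
      \<Rightarrow> (real \<Rightarrow> 'a \<Rightarrow> real) \<Rightarrow> bool" where
  "weak_wave_solution T \<Omega> \<rho> F u \<longleftrightarrow>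
     (\<forall>C. compact C \<and> C \<subseteq> \<Omega> \<longrightarrow>
        (\<lambda>(t, x). u t x) absolutely_integrable_on ({0..T} \<times> C) \<and>
        (\<lambda>(t, x). \<rho> x * u t x) absolutely_integrable_on ({0..T} \<times> C)) \<and>
     (\<forall>\<phi>. test_fun ({..<T} \<times> \<Omega>) \<phi> \<longrightarrow>
        integral ({0..T} \<times> \<Omega>)
          (\<lambda>(t, x). u t x * (\<rho> x * partials [(1, 0), (1, 0)] \<phi> (t, x)
                              - (\<Sum>i\<in>Basis. partials [(0, i), (0, i)] \<phi> (t, x))))
        = F \<phi>)"

definition sens_kernel ::
    "real \<Rightarrow> ('a \<Rightarrow> real) \<Rightarrow> (real \<Rightarrow> 'a \<Rightarrow> real) \<Rightarrow> (real \<Rightarrow> 'a \<Rightarrow> real) \<Rightarrow> 'a \<Rightarrow> real" where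
  "sens_kernel T \<rho> udag u x =
     integral {0..T} (\<lambda>t. \<rho> x * deriv (\<lambda>\<tau>. udag \<tau> x) (T - t) * deriv (\<lambda>\<tau>. u \<tau> x) t)"

definition mean_kernel :: "nat \<Rightarrow> nat \<Rightarrow> (nat \<Rightarrow> nat \<Rightarrow> 'a \<Rightarrow> real) \<Rightarrow> 'a \<Rightarrow> real" where
  "mean_kernel NR NS K x = 1 / (real NR * real NS) * (\<Sum>r = 1..NR. \<Sum>s = 1..NS. K r s x)"

definition batch_kernel ::
    "nat \<Rightarrow> nat \<Rightarrow> (nat \<Rightarrow> nat \<Rightarrow> 'a \<Rightarrow> real) \<Rightarrow> nat set \<Rightarrow> nat set \<Rightarrow> 'a \<Rightarrow> real" where
  "batch_kernel pR pS K A B x = 1 / (real pR * real pS) * (\<Sum>r\<in>A. \<Sum>s\<in>B. K r s x)"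

definition batch_error ::
    "nat \<Rightarrow> nat \<Rightarrow> nat \<Rightarrow> nat \<Rightarrow> (nat \<Rightarrow> nat \<Rightarrow> 'a \<Rightarrow> real) \<Rightarrow> nat set \<Rightarrow> nat set \<Rightarrow> 'a \<Rightarrow> real" where
  "batch_error NR NS pR pS K A B x = batch_kernel pR pS K A B x - mean_kernel NR NS K x"

definition receiver_kernel :: "nat \<Rightarrow> (nat \<Rightarrow> nat \<Rightarrow> 'a \<Rightarrow> real) \<Rightarrow> nat \<Rightarrow> 'a \<Rightarrow> real" where
  "receiver_kernel NS K r x = 1 / real NS * (\<Sum>s = 1..NS. K r s x)"

definition source_kernel ::
    "nat \<Rightarrow> (nat \<Rightarrow> nat \<Rightarrow> 'a \<Rightarrow> real) \<Rightarrow> nat set \<Rightarrow> nat \<Rightarrow> 'a \<Rightarrow> real" where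
  "source_kernel pR K A s x = 1 / real pR * (\<Sum>r\<in>A. K r s x)"

definition sample_variance :: "nat \<Rightarrow> (nat \<Rightarrow> real) \<Rightarrow> real" where
  "sample_variance N k =
     1 / (real N - 1) * (\<Sum>i = 1..N. (k i - 1 / real N * (\<Sum>l = 1..N. k l))\<^sup>2)"

definition Lambda_R :: "nat \<Rightarrow> nat \<Rightarrow> (nat \<Rightarrow> nat \<Rightarrow> 'a \<Rightarrow> real) \<Rightarrow> 'a \<Rightarrow> real" where
  "Lambda_R NR NS K x = sample_variance NR (\<lambda>r. receiver_kernel NS K r x)"

definition Lambda_S ::
    "nat \<Rightarrow> nat \<Rightarrow> (nat \<Rightarrow> nat \<Rightarrow> 'a \<Rightarrow> real) \<Rightarrow> nat set \<Rightarrow> 'a \<Rightarrow> real" where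
  "Lambda_S NS pR K A x = sample_variance NS (\<lambda>s. source_kernel pR K A s x)"

definition uniform_subset :: "'w measure \<Rightarrow> nat \<Rightarrow> nat \<Rightarrow> ('w \<Rightarrow> nat set) \<Rightarrow> bool" where
  "uniform_subset M N p X \<longleftrightarrow>
     X \<in> measurable M (count_space UNIV) \<and>
     distr M (count_space UNIV) X = measure_pmf (pmf_of_set {A. A \<subseteq> {1..N} \<and> card A = p})"

text \<open>The expectations of a batch quantity \<open>f pS A B\<close> (the number \<open>pS\<close> being the source batch size used
  in the normalisation).  In \<open>expect_S\<close>, the random source set is replaced by the set of all sources
  and \<open>pS\<close> by \<open>NS\<close>; this is not conditioning within \<open>M\<close>, where the event \<open>S = {1..NS}\<close>
  is null for \<open>pS < NS\<close>.\<close>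
definition expect ::
    "'w measure \<Rightarrow> nat \<Rightarrow> ('w \<Rightarrow> nat set) \<Rightarrow> ('w \<Rightarrow> nat set)
      \<Rightarrow> (nat \<Rightarrow> nat set \<Rightarrow> nat set \<Rightarrow> real) \<Rightarrow> real" where
  "expect M pS R S f = (\<integral>\<omega>. f pS (R \<omega>) (S \<omega>) \<partial>M)"

definition expect_S ::
    "'w measure \<Rightarrow> nat \<Rightarrow> ('w \<Rightarrow> nat set) \<Rightarrow> (nat \<Rightarrow> nat set \<Rightarrow> nat set \<Rightarrow> real) \<Rightarrow> real" where
  "expect_S M NS R f = (\<integral>\<omega>. f NS (R \<omega>) {1..NS} \<partial>M)"

end

theory Submission
  imports Defs
begin

text \<open>
  At a fixed point \<open>x\<close> the kernels form an array of real numbers, and the identities are those of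
  simple random sampling without replacement from its rows and columns.

  Let \<open>A\<close> be uniform among the subsets of size \<open>p\<close> of a population \<open>{1..N}\<close> with values \<open>a i\<close>.  A
  given \<open>J\<close> of size \<open>j\<close> lies in \<open>A\<close> with probability \<open>(p choose j) / (N choose j)\<close>
  (\<open>prob_contains_random_subset\<close>).  For \<open>j = 1\<close> this makes the sample mean unbiased; together with
  \<open>j = 2\<close> it gives, after centring the values,
  \<open>Var (1 / p * (\<Sum>i\<in>A. a i)) = (1 / p - 1 / N) * sample_variance N a\<close>.  Both facts are combined in
  \<open>expectation_sample_mean_error_sq\<close>, the bias-variance decomposition of the squared distance of the
  sample mean to an arbitrary constant \<open>c\<close>.

  When all sources are used, the batch kernel is the sample mean of the receiver kernels, and the
  decomposition with \<open>c\<close> the population mean is the formula for \<open>expect_S\<close>.  In general,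
  independence allows averaging over the source set first.  For a fixed receiver set \<open>A\<close> the batch
  kernel is the sample mean of the source kernels for \<open>A\<close>, and the decomposition with \<open>c\<close> the
  full mean kernel yields the term with \<open>Lambda_S\<close> plus the squared error for \<open>A\<close> and all
  sources.  Averaging over \<open>A\<close> finishes the proof.
\<close>

section \<open>Sampling without replacement\<close>

abbreviation subsets_of_size :: "'b set \<Rightarrow> nat \<Rightarrow> 'b set set" where
  "subsets_of_size I p \<equiv> {A. A \<subseteq> I \<and> card A = p}"

lemma subsets_of_size_nonempty:
  assumes "p \<le> card I"
  shows "subsets_of_size I p \<noteq> {}"
  using obtain_subset_with_card_n[OF assms] by blast

lemma card_subsets_of_size_containing:
  assumes "finite I" "J \<subseteq> I"
  shows "card {A \<in> subsets_of_size I p. J \<subseteq> A} * (card I choose card J)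
           = (card I choose p) * (p choose card J)"
proof (cases "card J \<le> p \<and> p \<le> card I")
  case True
  have fin: "finite J" "\<And>A. A \<subseteq> I \<Longrightarrow> finite A"
    using assms finite_subset by auto
  have "bij_betw (\<lambda>A. A - J) {A \<in> subsets_of_size I p. J \<subseteq> A} (subsets_of_size (I - J) (p - card J))"
  proof (rule bij_betw_byWitness[where f' = "\<lambda>B. B \<union> J"])
    show "(\<lambda>B. B \<union> J) ` subsets_of_size (I - J) (p - card J) \<subseteq> {A \<in> subsets_of_size I p. J \<subseteq> A}"
    proof
      fix A assume "A \<in> (\<lambda>B. B \<union> J) ` subsets_of_size (I - J) (p - card J)"
      then obtain B where B: "A = B \<union> J" "B \<subseteq> I - J" "card B = p - card J" by auto
      have "card A = card B + card J"
        unfolding B(1) using B(2) fin by (intro card_Un_disjoint) auto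
      then show "A \<in> {A \<in> subsets_of_size I p. J \<subseteq> A}" using B True assms by auto
    qed
    show "(\<lambda>A. A - J) ` {A \<in> subsets_of_size I p. J \<subseteq> A} \<subseteq> subsets_of_size (I - J) (p - card J)"
      using fin by (auto simp: card_Diff_subset)
  qed auto
  then have "card {A \<in> subsets_of_size I p. J \<subseteq> A} = card (subsets_of_size (I - J) (p - card J))"
    by (rule bij_betw_same_card)
  also have "\<dots> = (card I - card J) choose (p - card J)"
    using assms fin by (simp add: n_subsets card_Diff_subset)
  finally show ?thesis using choose_mult[of "card J" p "card I"] True by simp
next
  case False
  have "{A \<in> subsets_of_size I p. J \<subseteq> A} = {}"
    using False assms by (auto dest: card_mono[OF finite_subset] card_mono)
  then have "card {A \<in> subsets_of_size I p. J \<subseteq> A} = 0" by (metis card.empty)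
  then show ?thesis using False by (auto simp: binomial_eq_0)
qed

lemma expectation_random_subset:
  fixes f :: "'b set \<Rightarrow> real"
  assumes "finite I" "p \<le> card I"
  shows "measure_pmf.expectation (pmf_of_set (subsets_of_size I p)) f
           = (\<Sum>A\<in>subsets_of_size I p. f A) / card (subsets_of_size I p)"
  using assms subsets_of_size_nonempty by (intro integral_pmf_of_set) auto

lemma integrable_random_subset:
  fixes f :: "'b set \<Rightarrow> real"
  assumes "finite I" "p \<le> card I"
  shows "integrable (measure_pmf (pmf_of_set (subsets_of_size I p))) f"
  using assms subsets_of_size_nonempty[OF assms(2)]
  by (intro integrable_measure_pmf_finite) (simp add: set_pmf_of_set)

lemma prob_contains_random_subset:
  assumes "finite I" "p \<le> card I" "J \<subseteq> I"
  shows "measure_pmf.expectation (pmf_of_set (subsets_of_size I p)) (\<lambda>A. of_bool (J \<subseteq> A))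
           = real (p choose card J) / real (card I choose card J)"
proof -
  have "card J \<le> card I" using assms card_mono by blast
  then have pos: "real (card I choose card J) > 0" "real (card I choose p) > 0"
    using assms by (auto simp: zero_less_binomial_iff)
  have "(\<Sum>A\<in>subsets_of_size I p. of_bool (J \<subseteq> A)) = real (card {A \<in> subsets_of_size I p. J \<subseteq> A})"
    using assms(1) by (simp add: sum.If_cases of_bool_def Int_def)
  moreover have "real (card {A \<in> subsets_of_size I p. J \<subseteq> A}) * real (card I choose card J)
      = real (card I choose p) * real (p choose card J)"
    using card_subsets_of_size_containing[OF assms(1,3), of p] by (metis of_nat_mult)
  ultimately show ?thesis
    using pos assms by (simp add: expectation_random_subset n_subsets field_simps)
qed

lemma expectation_sum_random_subset:
  fixes a :: "'b \<Rightarrow> real"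
  assumes "finite I" "p \<le> card I"
  shows "measure_pmf.expectation (pmf_of_set (subsets_of_size I p)) (\<lambda>A. \<Sum>i\<in>A. a i)
           = real p / real (card I) * (\<Sum>i\<in>I. a i)"
    (is "?E (\<lambda>A. \<Sum>i\<in>A. a i) = _")
proof -
  note int = integrable_random_subset[OF assms]
  have "?E (\<lambda>A. \<Sum>i\<in>A. a i) = ?E (\<lambda>A. \<Sum>i\<in>I. a i * of_bool ({i} \<subseteq> A))"
    unfolding expectation_random_subset[OF assms]
    by (auto intro!: sum.cong arg_cong[where f = "\<lambda>x. x / _"] sum.mono_neutral_cong_left simp: assms)
  also have "\<dots> = (\<Sum>i\<in>I. a i * ?E (\<lambda>A. of_bool ({i} \<subseteq> A)))"
    by (subst Bochner_Integration.integral_sum) (simp_all only: int integral_mult_right_zero)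
  also have "\<dots> = (\<Sum>i\<in>I. a i * (real p / real (card I)))"
    by (intro sum.cong refl, subst prob_contains_random_subset) (use assms in auto)
  finally show ?thesis by (simp only: flip: sum_distrib_right) (simp only: mult.commute)
qed

text \<open>All pairs \<open>i \<noteq> j\<close> lie in the random subset with the same probability, and for centred values
  the mixed terms add up to \<open>(\<Sum>i\<in>I. \<Sum>j\<in>I - {i}. a i * a j) = - (\<Sum>i\<in>I. (a i)\<^sup>2)\<close>, so that
  only the sum of squares remains.  If \<open>card I \<le> 1\<close> then \<open>a\<close> vanishes on \<open>I\<close>, and the division by \<open>0\<close> is harmless.\<close>

lemma expectation_sum_sq_random_subset:
  fixes a :: "'b \<Rightarrow> real"
  assumes "finite I" "p \<le> card I" and centred: "(\<Sum>i\<in>I. a i) = 0"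
  shows "measure_pmf.expectation (pmf_of_set (subsets_of_size I p)) (\<lambda>A. (\<Sum>i\<in>A. a i)\<^sup>2)
           = real p * (real (card I) - real p) / (real (card I) * (real (card I) - 1)) * (\<Sum>i\<in>I. (a i)\<^sup>2)"
    (is "?E (\<lambda>A. (\<Sum>i\<in>A. a i)\<^sup>2) = _")
proof (cases "card I \<le> 1")
  case True
  then have "a i = 0" if "i \<in> I" for i
  proof -
    have "card I = 1" using True that assms(1) by (metis One_nat_def card_0_eq empty_iff le_SucE le_zero_eq)
    then have "I = {i}" using that by (metis card_1_singletonE singletonD)
    then show ?thesis using centred by simp
  qed
  moreover have "(\<Sum>i\<in>A. a i) = 0" if "A \<in> subsets_of_size I p" for A
    using that calculation by (intro sum.neutral) auto
  ultimately show ?thesis by (simp add: expectation_random_subset[OF assms(1,2)])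
next
  case False
  define N where "N = real (card I)"
  define Q where "Q = (\<Sum>i\<in>I. (a i)\<^sup>2)"
  have N: "N > 1" using False by (simp add: N_def)
  note int = integrable_random_subset[OF assms(1,2)]
  have choose2: "real (n choose 2) = real n * (real n - 1) / 2" for n
    by (induction n) (simp_all add: numeral_2_eq_2 field_simps)
  have pair: "?E (\<lambda>A. of_bool ({i, j} \<subseteq> A))
      = (if i = j then real p / N else real p * (real p - 1) / (N * (N - 1)))" if "i \<in> I" "j \<in> I" for i j
    using that N by (subst prob_contains_random_subset)
      (use assms in \<open>auto simp: card_insert_if N_def numeral_2_eq_2[symmetric] choose2\<close>)
  have "?E (\<lambda>A. (\<Sum>i\<in>A. a i)\<^sup>2) = ?E (\<lambda>A. \<Sum>i\<in>I. \<Sum>j\<in>I. a i * a j * of_bool ({i, j} \<subseteq> A))"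
  proof -
    have "(\<Sum>i\<in>A. a i)\<^sup>2 = (\<Sum>i\<in>I. \<Sum>j\<in>I. a i * a j * of_bool ({i, j} \<subseteq> A))"
      if "A \<subseteq> I" for A
    proof -
      have "(\<Sum>i\<in>A. a i) = (\<Sum>i\<in>I. a i * of_bool (i \<in> A))"
        using assms(1) that by (intro sum.mono_neutral_cong_left) auto
      then show ?thesis
        by (simp add: power2_eq_square sum_product of_bool_conj algebra_simps)
    qed
    then show ?thesis by (simp add: expectation_random_subset[OF assms(1,2)])
  qed
  also have "\<dots> = (\<Sum>i\<in>I. \<Sum>j\<in>I. a i * a j * ?E (\<lambda>A. of_bool ({i, j} \<subseteq> A)))"
    by (simp only: Bochner_Integration.integral_sum int integral_mult_right_zero)
  also have "\<dots> = (\<Sum>i\<in>I. \<Sum>j\<in>I. real p * (real p - 1) / (N * (N - 1)) * (a i * a j)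
      + (if i = j then (real p / N - real p * (real p - 1) / (N * (N - 1))) * (a i * a j) else 0))"
    by (intro sum.cong refl) (simp only: pair, simp add: algebra_simps)
  also have "\<dots> = real p * (real p - 1) / (N * (N - 1)) * ((\<Sum>i\<in>I. a i) * (\<Sum>j\<in>I. a j))
      + (real p / N - real p * (real p - 1) / (N * (N - 1))) * Q"
    unfolding sum.distrib sum_product unfolding sum_distrib_left Q_def
    using assms(1) by (simp add: power2_eq_square)
  also have "\<dots> = real p * (N - real p) / (N * (N - 1)) * Q"
    using N centred by (simp add: field_simps)
  finally show ?thesis by (simp add: N_def Q_def)
qed

lemma expectation_sample_mean:
  fixes a :: "nat \<Rightarrow> real"
  assumes "1 \<le> p" "p \<le> N"
  shows "measure_pmf.expectation (pmf_of_set (subsets_of_size {1..N} p)) (\<lambda>A. 1 / real p * (\<Sum>i\<in>A. a i))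
           = 1 / real N * (\<Sum>i = 1..N. a i)"
  using assms by (simp add: expectation_sum_random_subset)

text \<open>Bias-variance decomposition.  For \<open>N = 1\<close> both \<open>1 / p - 1 / N\<close> and \<open>sample_variance\<close> (with
  its \<open>1 / 0 = 0\<close>) vanish.\<close>

lemma expectation_sample_mean_error_sq:
  fixes a :: "nat \<Rightarrow> real"
  assumes p: "1 \<le> p" "p \<le> N"
  shows "measure_pmf.expectation (pmf_of_set (subsets_of_size {1..N} p))
             (\<lambda>A. (1 / real p * (\<Sum>i\<in>A. a i) - c)\<^sup>2)
           = (1 / real p - 1 / real N) * sample_variance N a + (1 / real N * (\<Sum>i = 1..N. a i) - c)\<^sup>2"
proof -
  let ?E = "measure_pmf.expectation (pmf_of_set (subsets_of_size {1..N} p))"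
  define \<mu> where "\<mu> = 1 / real N * (\<Sum>i = 1..N. a i)"
  define b where "b i = a i - \<mu>" for i
  have fin: "finite {1..N}" "p \<le> card {1..N}" using p by auto
  note int = integrable_random_subset[OF fin]
  have b0: "(\<Sum>i = 1..N. b i) = 0" using p by (simp add: b_def sum_subtractf \<mu>_def)
  \<comment> \<open>As \<open>card A = p\<close>, subtracting \<open>\<mu>\<close> from the values subtracts \<open>\<mu>\<close> from the sample mean.\<close>
  have "?E (\<lambda>A. (1 / real p * (\<Sum>i\<in>A. a i) - c)\<^sup>2)
      = ?E (\<lambda>A. (1 / real p)\<^sup>2 * (\<Sum>i\<in>A. b i)\<^sup>2 + 2 * (\<mu> - c) / real p * (\<Sum>i\<in>A. b i) + (\<mu> - c)\<^sup>2)"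
  proof -
    have "(1 / real p * (\<Sum>i\<in>A. a i) - c)\<^sup>2
        = (1 / real p)\<^sup>2 * (\<Sum>i\<in>A. b i)\<^sup>2 + 2 * (\<mu> - c) / real p * (\<Sum>i\<in>A. b i) + (\<mu> - c)\<^sup>2"
      if "card A = p" for A
    proof -
      have "1 / real p * (\<Sum>i\<in>A. a i) - c = 1 / real p * (\<Sum>i\<in>A. b i) + (\<mu> - c)"
        using p that by (simp add: b_def sum_subtractf field_simps)
      then show ?thesis
        using p by (simp only:) (simp add: power2_eq_square field_simps)
    qed
    then show ?thesis unfolding expectation_random_subset[OF fin] by simp
  qed
  also have "\<dots> = (1 / real p)\<^sup>2 * ?E (\<lambda>A. (\<Sum>i\<in>A. b i)\<^sup>2)
      + 2 * (\<mu> - c) / real p * ?E (\<lambda>A. \<Sum>i\<in>A. b i) + (\<mu> - c)\<^sup>2"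
    by (simp only: Bochner_Integration.integral_add int integral_mult_right_zero) simp
  also have "\<dots> = (1 / real p)\<^sup>2 * (real p * (real N - real p) / (real N * (real N - 1)) * (\<Sum>i = 1..N. (b i)\<^sup>2))
      + (\<mu> - c)\<^sup>2"
    unfolding expectation_sum_random_subset[OF fin] expectation_sum_sq_random_subset[OF fin b0]
    using b0 by simp
  also have "(1 / real p)\<^sup>2 * (real p * (real N - real p) / (real N * (real N - 1)) * (\<Sum>i = 1..N. (b i)\<^sup>2))
      = (1 / real p - 1 / real N) * sample_variance N a"
    unfolding sample_variance_def b_def \<mu>_def[symmetric] using p
    by (cases "N = 1") (simp_all add: field_simps power2_eq_square)
  finally show ?thesis by (simp add: \<mu>_def)
qed

section \<open>Functions of independent random subsets\<close>

lemma integral_uniform_subset: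
  fixes f :: "nat set \<Rightarrow> real"
  assumes "uniform_subset M N p X"
  shows "(\<integral>\<omega>. f (X \<omega>) \<partial>M) = measure_pmf.expectation (pmf_of_set (subsets_of_size {1..N} p)) f"
  using assms integral_distr[of X M "count_space UNIV" f] unfolding uniform_subset_def by simp

lemma (in prob_space) AE_uniform_subset:
  assumes "uniform_subset M N p X" "p \<le> N"
  shows "AE \<omega> in M. X \<omega> \<in> subsets_of_size {1..N} p"
proof -
  have X: "X \<in> measurable M (count_space UNIV)" using assms unfolding uniform_subset_def by simp
  have "AE A in distr M (count_space UNIV) X. A \<in> subsets_of_size {1..N} p"
  proof -
    have "distr M (count_space UNIV) X = measure_pmf (pmf_of_set (subsets_of_size {1..N} p))"
      using assms unfolding uniform_subset_def by simp
    moreover have "set_pmf (pmf_of_set (subsets_of_size {1..N} p)) = subsets_of_size {1..N} p"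
      using assms subsets_of_size_nonempty[of p "{1..N}"] by (intro set_pmf_of_set) auto
    ultimately show ?thesis by (simp only: AE_measure_pmf_iff) simp
  qed
  then show ?thesis using X by (subst (asm) AE_distr_iff) auto
qed

lemma (in prob_space) prob_uniform_subset:
  assumes X: "uniform_subset M N p X" and p: "p \<le> N" and A: "A \<in> subsets_of_size {1..N} p"
  shows "prob (X -` {A} \<inter> space M) = 1 / card (subsets_of_size {1..N} p)"
proof -
  have "prob (X -` {A} \<inter> space M) = measure (distr M (count_space UNIV) X) {A}"
    using X by (subst measure_distr) (auto simp: uniform_subset_def)
  also have "\<dots> = pmf (pmf_of_set (subsets_of_size {1..N} p)) A"
    using X by (simp add: uniform_subset_def measure_pmf_single)
  finally show ?thesis using A p subsets_of_size_nonempty[of p "{1..N}"] by (subst (asm) pmf_of_set) auto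
qed

text \<open>The product \<open>\<sigma>\<close>-algebra of two copies of the (uncountable) discrete space \<open>nat set\<close> need not be
  discrete, so measurability of the integrand is a separate assumption; and the joint law is computed
  on atoms instead of as a product measure.\<close>

lemma (in prob_space) integral_indep_uniform_subsets:
  fixes f :: "nat set \<Rightarrow> nat set \<Rightarrow> real"
  assumes X: "uniform_subset M N p X" "p \<le> N" and Y: "uniform_subset M N' q Y" "q \<le> N'"
    and indep: "indep_var (count_space UNIV) X (count_space UNIV) Y"
    and meas: "(\<lambda>\<omega>. f (X \<omega>) (Y \<omega>)) \<in> borel_measurable M"
  shows "(\<integral>\<omega>. f (X \<omega>) (Y \<omega>) \<partial>M)
           = measure_pmf.expectation (pmf_of_set (subsets_of_size {1..N} p)) (\<lambda>A.
               measure_pmf.expectation (pmf_of_set (subsets_of_size {1..N'} q)) (f A))"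
proof -
  let ?F = "subsets_of_size {1..N} p" and ?G = "subsets_of_size {1..N'} q"
  let ?E = "\<lambda>A B. (X -` {A} \<inter> space M) \<inter> (Y -` {B} \<inter> space M)"
  have rv [measurable]: "X \<in> measurable M (count_space UNIV)" "Y \<in> measurable M (count_space UNIV)"
    using X Y unfolding uniform_subset_def by auto
  have fin: "finite ?F" "finite ?G" by auto
  have ev: "?E A B \<in> events" for A B
    using measurable_sets[OF rv(1), of "{A}"] measurable_sets[OF rv(2), of "{B}"] by auto
  have "(\<integral>\<omega>. f (X \<omega>) (Y \<omega>) \<partial>M) = (\<integral>\<omega>. (\<Sum>A\<in>?F. \<Sum>B\<in>?G. f A B * indicator (?E A B) \<omega>) \<partial>M)"
  proof (rule integral_cong_AE)
    show "AE \<omega> in M. f (X \<omega>) (Y \<omega>) = (\<Sum>A\<in>?F. \<Sum>B\<in>?G. f A B * indicator (?E A B) \<omega>)"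
      using AE_uniform_subset[OF X] AE_uniform_subset[OF Y] AE_space
    proof eventually_elim
      case (elim \<omega>)
      have "(\<Sum>A\<in>?F. \<Sum>B\<in>?G. f A B * indicator (?E A B) \<omega>)
          = (\<Sum>A\<in>?F. if X \<omega> = A then \<Sum>B\<in>?G. if Y \<omega> = B then f A B else 0 else 0)"
        using elim(3) by (intro sum.cong refl) (auto intro!: sum.cong sum.neutral simp: indicator_def)
      also have "\<dots> = f (X \<omega>) (Y \<omega>)"
        using elim(1,2) by (simp only: sum.delta'[OF fin(1)] sum.delta'[OF fin(2)] if_True)
      finally show ?case by simp
    qed
    show "(\<lambda>\<omega>. \<Sum>A\<in>?F. \<Sum>B\<in>?G. f A B * indicator (?E A B) \<omega>) \<in> borel_measurable M"
      using ev by (intro borel_measurable_sum borel_measurable_times borel_measurable_indicator) auto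
  qed (fact meas)
  also have "\<dots> = (\<Sum>A\<in>?F. \<Sum>B\<in>?G. f A B * prob (?E A B))"
  proof -
    have "integrable M (\<lambda>\<omega>. f A B * indicator (?E A B) \<omega>)" for A B
      using ev[of A B] by (intro integrable_mult_right integrable_real_indicator emeasure_finite)
        (auto simp: less_top[symmetric])
    moreover have "(\<integral>\<omega>. f A B * indicator (?E A B) \<omega> \<partial>M) = f A B * prob (?E A B)" for A B
      using ev[of A B] sets.sets_into_space[OF ev[of A B]] by (simp add: Int_absorb2 Int_absorb1)
    ultimately show ?thesis
      by (simp only: Bochner_Integration.integral_sum Bochner_Integration.integrable_sum)
  qed
  also have "\<dots> = (\<Sum>A\<in>?F. \<Sum>B\<in>?G. f A B / (card ?F * card ?G))"
  proof (intro sum.cong refl)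
    fix A B assume AB: "A \<in> ?F" "B \<in> ?G"
    have "prob (?E A B) = prob (X -` {A} \<inter> space M) * prob (Y -` {B} \<inter> space M)"
      using indep_varD[OF indep, of "{A}" "{B}"] by (simp add: vimage_def Int_def conj_ac)
    also have "\<dots> = 1 / card ?F * (1 / card ?G)"
      by (simp only: prob_uniform_subset[OF X AB(1)] prob_uniform_subset[OF Y AB(2)])
    finally show "f A B * prob (?E A B) = f A B / (card ?F * card ?G)" by simp
  qed
  also have "\<dots> = (\<Sum>A\<in>?F. (\<Sum>B\<in>?G. f A B) / card ?G) / card ?F"
    by (simp add: sum_divide_distrib mult.commute)
  finally show ?thesis
    using X Y by (simp add: expectation_random_subset sum_divide_distrib mult.commute)
qed

section \<open>Batch kernels as sample means\<close>

lemma batch_error_all_sources: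
  "batch_error NR NS pR NS K A {1..NS} x
     = 1 / real pR * (\<Sum>r\<in>A. receiver_kernel NS K r x)
       - 1 / real NR * (\<Sum>r = 1..NR. receiver_kernel NS K r x)"
  by (simp add: batch_error_def batch_kernel_def mean_kernel_def receiver_kernel_def
      flip: sum_divide_distrib)

lemma batch_error_source_kernel:
  "batch_error NR NS pR q K A B x
     = 1 / real q * (\<Sum>s\<in>B. source_kernel pR K A s x) - mean_kernel NR NS K x"
  by (simp add: batch_error_def batch_kernel_def source_kernel_def mult.commute sum.swap[of _ B]
      flip: sum_divide_distrib)

text \<open>An infinite \<open>A\<close> gives the same (zero) batch kernel as the empty set.  Hence the random set \<open>X\<close>
  can be replaced by one with countably many values.\<close>

lemma borel_measurable_batch_error:
  assumes "X \<in> measurable M (count_space UNIV)" "Y \<in> measurable M (count_space UNIV)"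
  shows "(\<lambda>\<omega>. batch_error NR NS pR q K (X \<omega>) (Y \<omega>) x) \<in> borel_measurable M"
proof -
  define X' where "X' \<omega> = (if finite (X \<omega>) then X \<omega> else {})" for \<omega>
  have "X' = (\<lambda>A. if finite A then A else {}) \<circ> X" by (auto simp: X'_def)
  also have "\<dots> \<in> measurable M (count_space {A. finite A})"
    using assms(1) by (rule measurable_comp) auto
  finally have X': "X' \<in> measurable M (count_space {A. finite A})" .
  have "(\<lambda>\<omega>. batch_error NR NS pR q K (X' \<omega>) (Y \<omega>) x) \<in> borel_measurable M"
  proof (rule measurable_compose_countable'[OF _ X'])
    show "(\<lambda>\<omega>. batch_error NR NS pR q K A (Y \<omega>) x) \<in> borel_measurable M" for A
      using assms(2) by (rule measurable_compose) simp
    show "countable {A :: nat set. finite A}" by (rule countable_Collect_finite)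
  qed
  moreover have "batch_error NR NS pR q K (X' \<omega>) B x = batch_error NR NS pR q K (X \<omega>) B x" for \<omega> B
    by (simp add: X'_def batch_error_def batch_kernel_def)
  ultimately show ?thesis by simp
qed

section \<open>Mean and variance of the batch error\<close>

theorem lemma3p5:
  fixes T :: real
    and \<Omega> :: "'a::euclidean_space set"
    and Y :: "'a \<Rightarrow> real"
    and NR NS pR pS :: nat
    and xr xs :: "nat \<Rightarrow> 'a"
    and src :: "nat \<Rightarrow> (real \<times> 'a \<Rightarrow> real) \<Rightarrow> real"
    and u uobs :: "nat \<Rightarrow> real \<Rightarrow> 'a \<Rightarrow> real"
    and udag :: "nat \<Rightarrow> nat \<Rightarrow> real \<Rightarrow> 'a \<Rightarrow> real"
    and K :: "nat \<Rightarrow> nat \<Rightarrow> 'a \<Rightarrow> real"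
    and chi :: "'a \<Rightarrow> nat \<Rightarrow> nat set \<Rightarrow> nat set \<Rightarrow> real"
    and M :: "'w measure"
    and R S :: "'w \<Rightarrow> nat set"
  assumes "T > 0" and "open \<Omega>"
    and "1 \<le> pR" "pR \<le> NR" "1 \<le> pS" "pS \<le> NS"
    and "\<And>r. r \<in> {1..NR} \<Longrightarrow> xr r \<in> \<Omega>"
    and "\<And>s. s \<in> {1..NS} \<Longrightarrow> xs s \<in> \<Omega>"
    and "\<And>s. s \<in> {1..NS} \<Longrightarrow> distribution_on ({..<T} \<times> \<Omega>) (src s)"
    and "\<And>s. s \<in> {1..NS} \<Longrightarrow> supported_in ({..<T} \<times> \<Omega>) (src s) ({0..T} \<times> {xs s})"
    and "\<And>s. s \<in> {1..NS} \<Longrightarrow>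
           weak_wave_solution T \<Omega> (\<lambda>x. exp (Y x)) (src s) (u s)"
    and "\<And>r s. r \<in> {1..NR} \<Longrightarrow> s \<in> {1..NS} \<Longrightarrow>
           (\<lambda>t. uobs s (T - t) (xr r) - u s (T - t) (xr r)) absolutely_integrable_on {0..T}"
    and "\<And>r s. r \<in> {1..NR} \<Longrightarrow> s \<in> {1..NS} \<Longrightarrow>
           weak_wave_solution T \<Omega> (\<lambda>x. exp (Y x))
             (point_source T (\<lambda>t. uobs s (T - t) (xr r) - u s (T - t) (xr r)) (xr r))
             (udag r s)"
    and "\<And>r s. r \<in> {1..NR} \<Longrightarrow> s \<in> {1..NS} \<Longrightarrow>
           K r s = sens_kernel T (\<lambda>x. exp (Y x)) (udag r s) (u s)"
    and "prob_space M"
    and "uniform_subset M NR pR R" and "uniform_subset M NS pS S"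
    and "prob_space.indep_var M (count_space UNIV) R (count_space UNIV) S"
    and "\<And>x q A B. chi x q A B = batch_error NR NS pR q K A B x"
  shows "\<forall>x\<in>\<Omega>.
    expect_S M NS R (chi x) = 0 \<and>
    expect M pS R S (chi x) = 0 \<and>
    expect_S M NS R (\<lambda>q A B. (chi x q A B)\<^sup>2) = (1 / real pR - 1 / real NR) * Lambda_R NR NS K x \<and>
    expect M pS R S (\<lambda>q A B. (chi x q A B)\<^sup>2) =
      (1 / real pS - 1 / real NS) * (\<integral>\<omega>. Lambda_S NS pR K (R \<omega>) x \<partial>M)
      + expect_S M NS R (\<lambda>q A B. (chi x q A B)\<^sup>2)"
proof (intro ballI)
  fix x assume "x \<in> \<Omega>"
  interpret prob_space M by fact
  note R = \<open>uniform_subset M NR pR R\<close> and S = \<open>uniform_subset M NS pS S\<close>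
  note pR = \<open>1 \<le> pR\<close> \<open>pR \<le> NR\<close> and pS = \<open>1 \<le> pS\<close> \<open>pS \<le> NS\<close>
  note chi = \<open>\<And>x q A B. chi x q A B = batch_error NR NS pR q K A B x\<close>
  let ?ER = "measure_pmf.expectation (pmf_of_set (subsets_of_size {1..NR} pR))"
  let ?ES = "measure_pmf.expectation (pmf_of_set (subsets_of_size {1..NS} pS))"
  have int: "integrable (measure_pmf (pmf_of_set (subsets_of_size {1..NR} pR))) f"
      "integrable (measure_pmf (pmf_of_set (subsets_of_size {1..NS} pS))) f" for f :: "nat set \<Rightarrow> real"
    using pR pS by (intro integrable_random_subset; simp)+
  have meas: "(\<lambda>\<omega>. chi x pS (R \<omega>) (S \<omega>)) \<in> borel_measurable M"
    unfolding chi using R S by (intro borel_measurable_batch_error) (auto simp: uniform_subset_def)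
  have expect_S: "expect_S M NS R f = ?ER (\<lambda>A. f NS A {1..NS})" for f
    unfolding expect_S_def using R by (rule integral_uniform_subset)
  have expect: "expect M pS R S f = ?ER (\<lambda>A. ?ES (f pS A))"
    if "(\<lambda>\<omega>. f pS (R \<omega>) (S \<omega>)) \<in> borel_measurable M" for f
    unfolding expect_def
    using R pR(2) S pS(2) \<open>indep_var (count_space UNIV) R (count_space UNIV) S\<close> that
    by (rule integral_indep_uniform_subsets)

  have mean_S: "expect_S M NS R (chi x) = 0"
    unfolding expect_S chi batch_error_all_sources
    by (simp only: Bochner_Integration.integral_diff int expectation_sample_mean[OF pR]) simp
  \<comment> \<open>Averaging over the source batch replaces it by the set of all sources.\<close>
  have "?ES (chi x pS A) = chi x NS A {1..NS}" for A
    unfolding chi batch_error_source_kernel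
    by (simp only: Bochner_Integration.integral_diff int expectation_sample_mean[OF pS]) simp
  then have mean: "expect M pS R S (chi x) = 0"
    using mean_S meas by (simp add: expect expect_S)

  have var_S: "expect_S M NS R (\<lambda>q A B. (chi x q A B)\<^sup>2)
      = (1 / real pR - 1 / real NR) * Lambda_R NR NS K x"
    unfolding expect_S chi batch_error_all_sources expectation_sample_mean_error_sq[OF pR]
    by (simp add: Lambda_R_def)
  have "?ES (\<lambda>B. (chi x pS A B)\<^sup>2)
      = (1 / real pS - 1 / real NS) * Lambda_S NS pR K A x + (chi x NS A {1..NS})\<^sup>2" for A
    unfolding chi batch_error_source_kernel expectation_sample_mean_error_sq[OF pS]
    by (simp add: Lambda_S_def)
  then have "expect M pS R S (\<lambda>q A B. (chi x q A B)\<^sup>2)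
      = ?ER (\<lambda>A. (1 / real pS - 1 / real NS) * Lambda_S NS pR K A x + (chi x NS A {1..NS})\<^sup>2)"
    using meas by (simp add: expect)
  also have "\<dots> = (1 / real pS - 1 / real NS) * ?ER (\<lambda>A. Lambda_S NS pR K A x)
      + ?ER (\<lambda>A. (chi x NS A {1..NS})\<^sup>2)"
    by (simp only: Bochner_Integration.integral_add int integral_mult_right_zero)
  also have "\<dots> = (1 / real pS - 1 / real NS) * (\<integral>\<omega>. Lambda_S NS pR K (R \<omega>) x \<partial>M)
      + expect_S M NS R (\<lambda>q A B. (chi x q A B)\<^sup>2)"
    using integral_uniform_subset[OF R, of "\<lambda>A. Lambda_S NS pR K A x"] by (simp add: expect_S)
  finally show "expect_S M NS R (chi x) = 0 \<and>
    expect M pS R S (chi x) = 0 \<and>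
    expect_S M NS R (\<lambda>q A B. (chi x q A B)\<^sup>2) = (1 / real pR - 1 / real NR) * Lambda_R NR NS K x \<and>
    expect M pS R S (\<lambda>q A B. (chi x q A B)\<^sup>2) =
      (1 / real pS - 1 / real NS) * (\<integral>\<omega>. Lambda_S NS pR K (R \<omega>) x \<partial>M)
      + expect_S M NS R (\<lambda>q A B. (chi x q A B)\<^sup>2)"
    using mean_S mean var_S by blast
qed

end
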